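(* Let $\mathcal X$ be a normed vector space, $\mathcal Y$ an inner product space, $T,T_n:\mathcal X\to\mathcal Y$ ($n=1,2,\dots$) bounded linear operators, $y,y_n\in\mathcal Y$, $\alpha>0$, $\alpha_n\in\mathbb R$, $\mathcal D$ a subset of $\mathcal X$, and $W:\mathcal D\to\mathbb R$ a functional satisfying: (1) there exists $\gamma\ge 0$ such that $W(x)\ge-\gamma$ for all $x\in\mathcal D$; (2) for every $T$-$W$-bounded sequence $\{x_n\}\subset\mathcal D$ converging in norm to some $x\in\mathcal D$, there exists a subsequence $\{x_{n_j}\}$ such that $W(x)\le\liminf_{j\to\infty}W(x_{n_j})$; (3) for every $T$-$W$-bounded sequence $\{x_n\}\subset\mathcal D$ there exist a subsequence $\{x_{n_j}\}$ and $x\in\mathcal D$ such that $x_{n_j}\to x$ in norm. Define on $\mathcal D$ the functionals $$J(x)=\|Tx-y\|^2+\alpha W(x),\qquad J_n(x)=\|T_nx-y_n\|^2+\alpha_nW(x),\quad n=1,2,\dots,$$ and assume that as $n\to\infty$, $\alpha_n\to\alpha$, $y_n\to y$ and $T_nx\to Tx$ uniformly on $W$-bounded sets. Suppose further that $J$ has a unique global minimizer $\bar x$ on $\mathcal D$. If, for each $n$, $x_n$ is a global minimizer of $J_n$ on $\mathcal D$, then $x_n\to\bar x$ in norm.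
   Context: A sequence $\{x_n\}\subset\mathcal D$ is $T$-$W$-bounded if $\{\|Tx_n\|+W(x_n)\}$ is bounded in $\mathbb R$. A subset of $\mathcal D$ is $W$-bounded if there is a constant $k<\infty$ with $|W(x)|\le k$ for all its elements $x$. "$T_nx\to Tx$ uniformly on $W$-bounded sets" means: for any $c>0$ and $\epsilon>0$ there exists $N$ such that $\|T_nx-Tx\|<\epsilon$ for every $n\ge N$ and every $x\in\mathcal D$ with $|W(x)|\le c$. *)

theory Defs
  imports "HOL-Analysis.Analysis"
begin

text \<open>
  A functional \<open>W : D \<rightarrow> \<real>\<close> is rendered as a total function together with the set \<open>D\<close>; its values
  outside \<open>D\<close> are unconstrained and no definition below depends on them.
\<close>

definition tikhonov ::
  "('a \<Rightarrow> 'b::real_normed_vector) \<Rightarrow> 'b \<Rightarrow> real \<Rightarrow> ('a \<Rightarrow> real) \<Rightarrow> 'a \<Rightarrow> real" where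
  "tikhonov T y \<alpha> W x = (norm (T x - y))\<^sup>2 + \<alpha> * W x"

definition TW_bounded_seq ::
  "('a \<Rightarrow> 'b::real_normed_vector) \<Rightarrow> ('a \<Rightarrow> real) \<Rightarrow> 'a set \<Rightarrow> (nat \<Rightarrow> 'a) \<Rightarrow> bool" where
  "TW_bounded_seq T W D x \<longleftrightarrow>
     (\<forall>n. x n \<in> D) \<and> bounded (range (\<lambda>n. norm (T (x n)) + W (x n)))"

definition uniformly_on_W_bounded_sets ::
  "('a \<Rightarrow> real) \<Rightarrow> 'a set \<Rightarrow> (nat \<Rightarrow> 'a \<Rightarrow> 'b::real_normed_vector) \<Rightarrow> ('a \<Rightarrow> 'b) \<Rightarrow> bool" where
  "uniformly_on_W_bounded_sets W D Tn T \<longleftrightarrow>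
     (\<forall>c>0. \<forall>\<epsilon>>0. \<exists>N. \<forall>n\<ge>N. \<forall>x\<in>D. \<bar>W x\<bar> \<le> c \<longrightarrow> norm (Tn n x - T x) < \<epsilon>)"

end

theory Submission
  imports Defs
begin

text \<open>
  The minimizers \<open>xn\<close> of the perturbed functionals form a minimizing sequence for the
  limit functional \<open>J\<close>, and minimizing sequences of \<open>J\<close> converge to its unique minimizer.

  The second half (\<open>minimizing_sequence_converges\<close>) is the direct method. The values of \<open>J\<close> along a
  minimizing sequence are bounded, and since \<open>W\<close> is bounded below, both summands of \<open>J\<close> are bounded,
  so compactness applies to every subsequence. Continuity of \<open>T\<close> and lower semicontinuity of \<open>W\<close> show
  that each cluster point obtained in this way minimizes \<open>J\<close>, hence is \<open>xbar\<close>.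

  For the first half, optimality gives \<open>Jn (xn) \<le> Jn (xbar) \<rightarrow> J xbar\<close>. As \<open>\<alpha>n\<close> stays away from \<open>0\<close>,
  this bounds \<open>W (xn)\<close> for all large \<open>n\<close>, so that the uniform convergence of the operators can be used
  along \<open>xn\<close> itself: \<open>J (xn) - Jn (xn) \<rightarrow> 0\<close> (\<open>tikhonov_perturbation_tendsto_0\<close>). Therefore
  \<open>J xbar \<le> J (xn) \<le> Jn (xbar) + (J (xn) - Jn (xn))\<close>, and both ends tend to \<open>J xbar\<close>.
\<close>

section \<open>Convergence of the functionals along sequences with bounded \<open>W\<close>\<close>

text \<open>
  Only the differences of residuals are controlled, since \<open>T (u n)\<close> itself need not converge.
  The bound on \<open>W\<close> is only asked for eventually, because optimality of \<open>xn\<close> yields no common bound for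
  the indices at which \<open>\<alpha>n\<close> is still far from \<open>\<alpha>\<close>.
\<close>

lemma perturbed_residual_norm_tendsto:
  fixes T :: "'a \<Rightarrow> 'b::real_normed_vector"
  assumes unif: "uniformly_on_W_bounded_sets W D Tn T" and yn: "yn \<longlonglongrightarrow> y"
    and D: "\<And>n. u n \<in> D" and W: "\<forall>\<^sub>F n in sequentially. \<bar>W (u n)\<bar> \<le> c"
  shows "(\<lambda>n. norm (T (u n) - y) - norm (Tn n (u n) - yn n)) \<longlonglongrightarrow> 0"
proof -
  have "(\<lambda>n. Tn n (u n) - T (u n)) \<longlonglongrightarrow> 0"
  proof (rule tendstoI)
    fix \<epsilon> :: real assume "\<epsilon> > 0"
    then obtain N where N: "\<And>n x. n \<ge> N \<Longrightarrow> x \<in> D \<Longrightarrow> \<bar>W x\<bar> \<le> max c 1 \<Longrightarrow> norm (Tn n x - T x) < \<epsilon>"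
      using unif unfolding uniformly_on_W_bounded_sets_def by (metis less_max_iff_disj zero_less_one)
    show "\<forall>\<^sub>F n in sequentially. dist (Tn n (u n) - T (u n)) 0 < \<epsilon>"
      using W eventually_ge_at_top[of N] by eventually_elim (auto intro: N D)
  qed
  moreover have "(\<lambda>n. yn n - y) \<longlonglongrightarrow> 0"
    using yn by (simp add: LIM_zero_iff)
  ultimately have lim: "(\<lambda>n. (Tn n (u n) - T (u n)) - (yn n - y)) \<longlonglongrightarrow> 0"
    using tendsto_diff by fastforce
  show ?thesis
  proof (rule Lim_null_comparison[OF always_eventually tendsto_norm_zero[OF lim]], intro allI)
    fix n
    have "(Tn n (u n) - T (u n)) - (yn n - y) = - ((T (u n) - y) - (Tn n (u n) - yn n))"
      by simp
    then show "norm (norm (T (u n) - y) - norm (Tn n (u n) - yn n))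
        \<le> norm ((Tn n (u n) - T (u n)) - (yn n - y))"
      by (simp only: norm_minus_cancel real_norm_def norm_triangle_ineq3)
  qed
qed

text \<open>
  With \<open>b\<close> the perturbed residual norm and \<open>d\<close> its deviation from the exact one, the difference of
  the squares is \<open>d * d + 2 * d * b\<close>; it vanishes in the limit because \<open>b\<close> stays bounded.
\<close>

lemma tikhonov_perturbation_tendsto_0:
  fixes T :: "'a \<Rightarrow> 'b::real_normed_vector"
  assumes unif: "uniformly_on_W_bounded_sets W D Tn T" and yn: "yn \<longlonglongrightarrow> y" and \<alpha>n: "\<alpha>n \<longlonglongrightarrow> \<alpha>"
    and D: "\<And>n. u n \<in> D" and W: "\<forall>\<^sub>F n in sequentially. \<bar>W (u n)\<bar> \<le> c"
    and res: "\<forall>\<^sub>F n in sequentially. norm (Tn n (u n) - yn n) \<le> k"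
  shows "(\<lambda>n. tikhonov T y \<alpha> W (u n) - tikhonov (Tn n) (yn n) (\<alpha>n n) W (u n)) \<longlonglongrightarrow> 0"
proof -
  define b where "b n = norm (Tn n (u n) - yn n)" for n
  define d where "d n = norm (T (u n) - y) - norm (Tn n (u n) - yn n)" for n
  have d: "d \<longlonglongrightarrow> 0"
    unfolding d_def by (rule perturbed_residual_norm_tendsto[OF unif yn D W])
  have "(\<lambda>n. d n * b n) \<longlonglongrightarrow> 0"
    by (rule lim_null_mult_right_bounded[OF d])
       (use res in \<open>auto simp: b_def elim: eventually_mono\<close>)
  moreover have "(\<lambda>n. (\<alpha> - \<alpha>n n) * W (u n)) \<longlonglongrightarrow> 0"
  proof (rule lim_null_mult_right_bounded)
    show "(\<lambda>n. \<alpha> - \<alpha>n n) \<longlonglongrightarrow> 0"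
      using tendsto_diff[OF tendsto_const \<alpha>n, of \<alpha>] by simp
    show "\<forall>\<^sub>F n in sequentially. norm (W (u n)) \<le> c"
      using W by simp
  qed
  ultimately have "(\<lambda>n. d n * d n + 2 * (d n * b n) + (\<alpha> - \<alpha>n n) * W (u n)) \<longlonglongrightarrow> 0 * 0 + 2 * 0 + 0"
    by (intro tendsto_intros d)
  then show ?thesis
    by (simp add: tikhonov_def b_def d_def algebra_simps power2_eq_square)
qed

section \<open>Minimizing sequences\<close>

text \<open>
  As \<open>W\<close> is bounded below, an upper bound on the sum of the two terms of the functional is an upper
  bound on each of them.
\<close>

lemma TW_bounded_seq_if_tikhonov_bounded:
  fixes T :: "'a \<Rightarrow> 'b::real_normed_vector"
  assumes \<alpha>: "\<alpha> > 0" and below: "\<And>x. x \<in> D \<Longrightarrow> W x \<ge> - \<gamma>"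
    and D: "\<And>n. u n \<in> D" and bound: "\<And>n. tikhonov T y \<alpha> W (u n) \<le> K"
  shows "TW_bounded_seq T W D u"
proof -
  have "\<bar>norm (T (u n)) + W (u n)\<bar> \<le> (K + \<alpha> * \<gamma> + 1) + norm y + \<bar>K\<bar> / \<alpha> + \<bar>\<gamma>\<bar>" for n
  proof -
    let ?r = "norm (T (u n) - y)"
    have J: "?r\<^sup>2 + \<alpha> * W (u n) \<le> K"
      using bound[of n] by (simp add: tikhonov_def)
    have "\<alpha> * W (u n) \<le> \<bar>K\<bar>"
      using J zero_le_power2[of ?r] by linarith
    then have W: "W (u n) \<le> \<bar>K\<bar> / \<alpha>"
      using \<alpha> by (simp add: field_simps)
    have "\<alpha> * W (u n) \<ge> \<alpha> * (- \<gamma>)"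
      using \<alpha> below[OF D[of n]] by (intro mult_left_mono) auto
    then have r2: "?r\<^sup>2 \<le> K + \<alpha> * \<gamma>"
      using J by simp
    \<comment> \<open>A linear bound in place of a square root: \<open>r \<le> r\<^sup>2 + 1\<close> for \<open>r \<ge> 0\<close>.\<close>
    have "2 * ?r \<le> ?r\<^sup>2 + 1"
      using zero_le_power2[of "?r - 1"] by (simp add: power2_diff)
    moreover have "0 \<le> ?r" by simp
    ultimately have "?r \<le> K + \<alpha> * \<gamma> + 1"
      using r2 by linarith
    moreover have "norm (T (u n)) \<le> ?r + norm y"
      by (metis diff_add_cancel norm_triangle_ineq)
    moreover have "W (u n) \<ge> - \<gamma>" "norm (T (u n)) \<ge> 0" "norm y \<ge> 0" "\<bar>K\<bar> / \<alpha> \<ge> 0"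
      using below[OF D[of n]] \<alpha> by auto
    ultimately show ?thesis
      using W by linarith
  qed
  then show ?thesis
    unfolding TW_bounded_seq_def using D by (auto simp: bounded_iff)
qed

text \<open>
  Once \<open>T v\<close> and \<open>J v\<close> converge, so does \<open>W v\<close>; the limit inferior of \<open>W\<close> along any subsequence is
  then this limit, and lower semicontinuity passes to \<open>J\<close>.
\<close>

lemma tikhonov_le_limit:
  fixes T :: "'a::real_normed_vector \<Rightarrow> 'b::real_normed_vector"
  assumes T: "bounded_linear T" and \<alpha>: "\<alpha> > 0" and v: "v \<longlonglongrightarrow> x"
    and lsc: "\<exists>r. strict_mono (r :: nat \<Rightarrow> nat) \<and> ereal (W x) \<le> liminf (\<lambda>j. ereal (W (v (r j))))"
    and J: "(\<lambda>n. tikhonov T y \<alpha> W (v n)) \<longlonglongrightarrow> m"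
  shows "tikhonov T y \<alpha> W x \<le> m"
proof -
  obtain r :: "nat \<Rightarrow> nat" where r: "strict_mono r"
    and le: "ereal (W x) \<le> liminf (\<lambda>j. ereal (W (v (r j))))"
    using lsc by blast
  define L where "L = (m - (norm (T x - y))\<^sup>2) / \<alpha>"
  have "(\<lambda>n. (tikhonov T y \<alpha> W (v n) - (norm (T (v n) - y))\<^sup>2) / \<alpha>) \<longlonglongrightarrow> L"
    unfolding L_def using \<alpha> by (intro tendsto_intros J bounded_linear.tendsto[OF T v]) auto
  then have "(\<lambda>n. W (v n)) \<longlonglongrightarrow> L"
    using \<alpha> by (simp add: tikhonov_def)
  then have "(\<lambda>j. ereal (W (v (r j)))) \<longlonglongrightarrow> ereal L"
    using LIMSEQ_subseq_LIMSEQ[OF _ r] by (fastforce simp: o_def)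
  then have "liminf (\<lambda>j. ereal (W (v (r j)))) = ereal L"
    by (intro lim_imp_Liminf) auto
  with le have "W x \<le> L" by simp
  then show ?thesis
    using \<alpha> by (simp add: L_def tikhonov_def field_simps)
qed

lemma LIMSEQ_if_subseqs_have_convergent_subseq:
  fixes u :: "nat \<Rightarrow> 'a::metric_space"
  assumes "\<And>s. strict_mono (s :: nat \<Rightarrow> nat) \<Longrightarrow>
    \<exists>r. strict_mono (r :: nat \<Rightarrow> nat) \<and> (\<lambda>j. u (s (r j))) \<longlonglongrightarrow> x"
  shows "u \<longlonglongrightarrow> x"
proof (rule ccontr)
  assume "\<not> u \<longlonglongrightarrow> x"
  then obtain e where e: "e > 0" and "\<forall>N. \<exists>n\<ge>N. \<not> dist (u n) x < e"
    unfolding lim_sequentially by blast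
  then have "infinite {n. \<not> dist (u n) x < e}"
    unfolding infinite_nat_iff_unbounded_le by simp
  then obtain s :: "nat \<Rightarrow> nat" where s: "strict_mono s" and far: "\<And>n. \<not> dist (u (s n)) x < e"
    using infinite_enumerate by blast
  from assms[OF s] obtain r :: "nat \<Rightarrow> nat" where "(\<lambda>j. u (s (r j))) \<longlonglongrightarrow> x"
    by blast
  then show False
    using e far unfolding lim_sequentially by blast
qed

lemma minimizing_sequence_converges:
  fixes T :: "'a::real_normed_vector \<Rightarrow> 'b::real_normed_vector"
  assumes T: "bounded_linear T" and \<alpha>: "\<alpha> > 0"
    and below: "\<And>x. x \<in> D \<Longrightarrow> W x \<ge> - \<gamma>"
    and lsc: "\<And>u x. TW_bounded_seq T W D u \<Longrightarrow> x \<in> D \<Longrightarrow> u \<longlonglongrightarrow> x \<Longrightarrow>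
         \<exists>r. strict_mono (r :: nat \<Rightarrow> nat) \<and> ereal (W x) \<le> liminf (\<lambda>j. ereal (W (u (r j))))"
    and compact: "\<And>u. TW_bounded_seq T W D u \<Longrightarrow>
         \<exists>r. strict_mono (r :: nat \<Rightarrow> nat) \<and> (\<exists>x\<in>D. (\<lambda>j. u (r j)) \<longlonglongrightarrow> x)"
    and min: "is_arg_min (tikhonov T y \<alpha> W) (\<lambda>x. x \<in> D) xbar"
    and unique: "\<And>x. is_arg_min (tikhonov T y \<alpha> W) (\<lambda>x. x \<in> D) x \<Longrightarrow> x = xbar"
    and D: "\<And>n. u n \<in> D"
    and J: "(\<lambda>n. tikhonov T y \<alpha> W (u n)) \<longlonglongrightarrow> tikhonov T y \<alpha> W xbar"
  shows "u \<longlonglongrightarrow> xbar"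
proof (rule LIMSEQ_if_subseqs_have_convergent_subseq)
  fix s :: "nat \<Rightarrow> nat" assume s: "strict_mono s"
  obtain K where K: "\<And>n. tikhonov T y \<alpha> W (u n) \<le> K"
    using convergent_imp_Bseq[OF convergentI[OF J]]
    by (metis Bseq_def abs_le_D1 real_norm_def)
  have bdd: "TW_bounded_seq T W D (\<lambda>j. u (f j))" for f :: "nat \<Rightarrow> nat"
    using TW_bounded_seq_if_tikhonov_bounded[OF \<alpha> below D K] .
  obtain r :: "nat \<Rightarrow> nat" and x where r: "strict_mono r" and x: "x \<in> D"
    and lim: "(\<lambda>j. u (s (r j))) \<longlonglongrightarrow> x"
    using compact[OF bdd] by blast
  have "strict_mono (s \<circ> r)"
    using s r by (rule strict_mono_o)
  then have "(\<lambda>j. tikhonov T y \<alpha> W (u (s (r j)))) \<longlonglongrightarrow> tikhonov T y \<alpha> W xbar"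
    using LIMSEQ_subseq_LIMSEQ[OF J] by (fastforce simp: o_def)
  then have "tikhonov T y \<alpha> W x \<le> tikhonov T y \<alpha> W xbar"
    by (rule tikhonov_le_limit[OF T \<alpha> lim lsc[OF bdd x lim]])
  then have "is_arg_min (tikhonov T y \<alpha> W) (\<lambda>x. x \<in> D) x"
    using min x by (force simp: is_arg_min_linorder)
  with lim r unique show "\<exists>r. strict_mono (r :: nat \<Rightarrow> nat) \<and> (\<lambda>j. u (s (r j))) \<longlonglongrightarrow> xbar"
    by blast
qed

section \<open>Stability of minimizers\<close>

theorem corollary3p13:
  fixes T :: "'a::real_normed_vector \<Rightarrow> 'b::real_inner"
    and Tn :: "nat \<Rightarrow> 'a \<Rightarrow> 'b"
    and y :: 'b and yn :: "nat \<Rightarrow> 'b"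
    and \<alpha> :: real and \<alpha>n :: "nat \<Rightarrow> real"
    and D :: "'a set" and W :: "'a \<Rightarrow> real"
    and xbar :: 'a and xn :: "nat \<Rightarrow> 'a"
  assumes "bounded_linear T"
    and "\<And>n. bounded_linear (Tn n)"
    and "\<alpha> > 0"
    and W_bounded_below: "\<exists>\<gamma>\<ge>0. \<forall>x\<in>D. W x \<ge> - \<gamma>"
    and W_lower_semicontinuous:
      "\<And>u x. TW_bounded_seq T W D u \<Longrightarrow> x \<in> D \<Longrightarrow> u \<longlonglongrightarrow> x \<Longrightarrow>
         \<exists>r. strict_mono (r :: nat \<Rightarrow> nat) \<and>
             ereal (W x) \<le> liminf (\<lambda>j. ereal (W (u (r j))))"
    and TW_compact:
      "\<And>u. TW_bounded_seq T W D u \<Longrightarrow>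
         \<exists>r. strict_mono (r :: nat \<Rightarrow> nat) \<and> (\<exists>x\<in>D. (\<lambda>j. u (r j)) \<longlonglongrightarrow> x)"
    and "\<alpha>n \<longlonglongrightarrow> \<alpha>"
    and "yn \<longlonglongrightarrow> y"
    and "uniformly_on_W_bounded_sets W D Tn T"
    and xbar_minimizer: "is_arg_min (tikhonov T y \<alpha> W) (\<lambda>x. x \<in> D) xbar"
    and xbar_unique: "\<And>x. is_arg_min (tikhonov T y \<alpha> W) (\<lambda>x. x \<in> D) x \<Longrightarrow> x = xbar"
    and xn_minimizer:
      "\<And>n. is_arg_min (tikhonov (Tn n) (yn n) (\<alpha>n n) W) (\<lambda>x. x \<in> D) (xn n)"
  shows "xn \<longlonglongrightarrow> xbar"
proof -
  note unif = \<open>uniformly_on_W_bounded_sets W D Tn T\<close>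
  let ?J = "tikhonov T y \<alpha> W"
  let ?Jn = "\<lambda>n. tikhonov (Tn n) (yn n) (\<alpha>n n) W"
  obtain \<gamma> where \<gamma>: "\<gamma> \<ge> 0" and below: "\<And>x. x \<in> D \<Longrightarrow> W x \<ge> - \<gamma>"
    using W_bounded_below by blast
  have xbar: "xbar \<in> D" and J_min: "\<And>x. x \<in> D \<Longrightarrow> ?J xbar \<le> ?J x"
    using xbar_minimizer by (auto simp: is_arg_min_linorder)
  have xn: "\<And>n. xn n \<in> D" and Jn_min: "\<And>n x. x \<in> D \<Longrightarrow> ?Jn n (xn n) \<le> ?Jn n x"
    using xn_minimizer by (auto simp: is_arg_min_linorder)

  have Jn_xbar: "(\<lambda>n. ?Jn n xbar) \<longlonglongrightarrow> ?J xbar"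
  proof -
    have "(\<lambda>n. norm (T xbar - y) - norm (Tn n xbar - yn n)) \<longlonglongrightarrow> 0"
      by (rule perturbed_residual_norm_tendsto[OF unif \<open>yn \<longlonglongrightarrow> y\<close>, where c = "\<bar>W xbar\<bar>"])
         (auto simp: xbar)
    from tendsto_diff[OF tendsto_const this, of "norm (T xbar - y)"]
    have "(\<lambda>n. norm (Tn n xbar - yn n)) \<longlonglongrightarrow> norm (T xbar - y)"
      by simp
    then show ?thesis
      unfolding tikhonov_def
      by (intro tendsto_add tendsto_mult tendsto_power tendsto_const \<open>\<alpha>n \<longlonglongrightarrow> \<alpha>\<close>)
  qed

  define K where "K = ?J xbar + 1"
  have Jn_le: "\<forall>\<^sub>F n in sequentially. ?Jn n (xn n) \<le> K"
  proof -
    have "\<forall>\<^sub>F n in sequentially. ?Jn n xbar < K"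
      unfolding K_def using Jn_xbar by (rule order_tendstoD) simp
    then show ?thesis
      using Jn_min[OF xbar] by (auto elim!: eventually_mono intro: order.trans less_imp_le)
  qed
  have \<alpha>n_bounds: "\<forall>\<^sub>F n in sequentially. \<alpha> / 2 < \<alpha>n n \<and> \<alpha>n n < 2 * \<alpha>"
    using \<open>\<alpha> > 0\<close> by (intro eventually_conj order_tendstoD[OF \<open>\<alpha>n \<longlonglongrightarrow> \<alpha>\<close>]) auto

  have W_xn: "\<forall>\<^sub>F n in sequentially. \<bar>W (xn n)\<bar> \<le> \<gamma> + 2 * \<bar>K\<bar> / \<alpha>"
    using Jn_le \<alpha>n_bounds
  proof eventually_elim
    case (elim n)
    have "W (xn n) \<le> 2 * \<bar>K\<bar> / \<alpha>"
    proof (cases "W (xn n) \<le> 0")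
      case True
      also have "0 \<le> 2 * \<bar>K\<bar> / \<alpha>" using \<open>\<alpha> > 0\<close> by simp
      finally show ?thesis .
    next
      case False
      then have "\<alpha> / 2 * W (xn n) \<le> \<alpha>n n * W (xn n)"
        using elim by (intro mult_right_mono) auto
      also have "\<dots> \<le> K"
        using elim zero_le_power2[of "norm (Tn n (xn n) - yn n)"] unfolding tikhonov_def
        by linarith
      finally have "\<alpha> / 2 * W (xn n) \<le> \<bar>K\<bar>" by linarith
      then show ?thesis
        using \<open>\<alpha> > 0\<close> by (simp add: field_simps)
    qed
    moreover have "2 * \<bar>K\<bar> / \<alpha> \<ge> 0" using \<open>\<alpha> > 0\<close> by simp
    ultimately show ?case
      using below[OF xn[of n]] \<gamma> by linarith
  qed

  have residual_xn: "\<forall>\<^sub>F n in sequentially. norm (Tn n (xn n) - yn n) \<le> sqrt (K + 2 * \<alpha> * \<gamma>)"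
    using Jn_le \<alpha>n_bounds
  proof eventually_elim
    case (elim n)
    have "\<alpha>n n * W (xn n) \<ge> \<alpha>n n * (- \<gamma>)"
      using elim \<open>\<alpha> > 0\<close> below[OF xn[of n]] by (intro mult_left_mono) auto
    moreover have "\<alpha>n n * \<gamma> \<le> 2 * \<alpha> * \<gamma>"
      using elim \<gamma> by (intro mult_right_mono) auto
    ultimately have "(norm (Tn n (xn n) - yn n))\<^sup>2 \<le> K + 2 * \<alpha> * \<gamma>"
      using elim by (simp add: tikhonov_def)
    then show ?case by (rule real_le_rsqrt)
  qed

  have diff: "(\<lambda>n. ?J (xn n) - ?Jn n (xn n)) \<longlonglongrightarrow> 0"
    by (rule tikhonov_perturbation_tendsto_0[OF unif \<open>yn \<longlonglongrightarrow> y\<close> \<open>\<alpha>n \<longlonglongrightarrow> \<alpha>\<close> xn W_xn residual_xn])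
  have "(\<lambda>n. ?J (xn n)) \<longlonglongrightarrow> ?J xbar"
  proof (rule tendsto_sandwich[OF _ _ tendsto_const])
    show "\<forall>\<^sub>F n in sequentially. ?J xbar \<le> ?J (xn n)"
      using J_min xn by simp
    show "\<forall>\<^sub>F n in sequentially. ?J (xn n) \<le> ?Jn n xbar + (?J (xn n) - ?Jn n (xn n))"
      using Jn_min[OF xbar] by simp
    show "(\<lambda>n. ?Jn n xbar + (?J (xn n) - ?Jn n (xn n))) \<longlonglongrightarrow> ?J xbar"
      using tendsto_add[OF Jn_xbar diff] by simp
  qed
  with \<open>bounded_linear T\<close> \<open>\<alpha> > 0\<close> below W_lower_semicontinuous TW_compact
    xbar_minimizer xbar_unique xn
  show ?thesis
    by (rule minimizing_sequence_converges)
qed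

end
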